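(* Let $(i,j,k)\in\mathcal{F}$ be a face of the mesh, let $\gamma\geq 1$ be an integer, and let $\varepsilon_1,\ldots,\varepsilon_\gamma\geq 0$ be real weights, not all zero. Consider the function of $\mathbf{p}_{1,1,1}^{i,j,k}\in\mathbb{R}^3$ $$ \begin{aligned} \widetilde{E}_{i,j,k}^{\gamma}(\mathbf{p}_{1,1,1}^{i,j,k})={}&2\sum_{g=1}^{\gamma}\varepsilon_g\sum_{z=0}^{g}\binom{g}{z}\Big\langle \sum_{\substack{r=0\\ r\neq 1}}^{3}\sum_{s=0}^{3-r}\tau_{r,s,3-r-s}^{z,g-z}\,\mathbf{p}_{r,s,3-r-s}^{i,j,k}+\sum_{\substack{s=0\\ s\neq 1}}^{2}\tau_{1,s,2-s}^{z,g-z}\,\mathbf{p}_{1,s,2-s}^{i,j,k},\ \mathbf{p}_{1,1,1}^{i,j,k}\Big\rangle\\ &+\Big(\sum_{g=1}^{\gamma}\varepsilon_g\sum_{z=0}^{g}\binom{g}{z}\tau_{1,1,1}^{z,g-z}\Big)\langle\mathbf{p}_{1,1,1}^{i,j,k},\mathbf{p}_{1,1,1}^{i,j,k}\rangle , \end{aligned} $$ which is the $\mathbf{p}_{1,1,1}^{i,j,k}$-dependent part of the energy functional $E_{i,j,k}^{\gamma}$. Provided that the function system $\mathcal{T}_\beta$, the order $\gamma$ and the weights $\{\varepsilon_g\}_{g=1}^{\gamma}$ are chosen such that the coefficient $\sum_{g=1}^{\gamma}\varepsilon_g\sum_{z=0}^{g}\binom{g}{z}\tau_{1,1,1}^{z,g-z}$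 of $\langle\mathbf{p}_{1,1,1}^{i,j,k},\mathbf{p}_{1,1,1}^{i,j,k}\rangle$ is not zero, the solution of $$ \begin{aligned} \frac{\partial}{\partial\mathbf{p}_{1,1,1}^{i,j,k}}\widetilde{E}_{i,j,k}^{\gamma}(\mathbf{p}_{1,1,1}^{i,j,k}):={}&2\sum_{g=1}^{\gamma}\varepsilon_g\sum_{z=0}^{g}\binom{g}{z}\Big(\sum_{\substack{r=0\\ r\neq 1}}^{3}\sum_{s=0}^{3-r}\tau_{r,s,3-r-s}^{z,g-z}\,\mathbf{p}_{r,s,3-r-s}^{i,j,k}+\sum_{\substack{s=0\\ s\neq 1}}^{2}\tau_{1,s,2-s}^{z,g-z}\,\mathbf{p}_{1,s,2-s}^{i,j,k}\Big)\\ &+\Big(2\sum_{g=1}^{\gamma}\varepsilon_g\sum_{z=0}^{g}\binom{g}{z}\tau_{1,1,1}^{z,g-z}\Big)\mathbf{p}_{1,1,1}^{i,j,k}=\mathbf{0} \end{aligned} $$ is the unique critical control point $$ \mathbf{p}_{1,1,1}^{i,j,k}=-\frac{\displaystyle\sum_{g=1}^{\gamma}\varepsilon_g\sum_{z=0}^{g}\binom{g}{z}\Big(\sum_{\substack{r=0\\ r\neq 1}}^{3}\sum_{s=0}^{3-r}\tau_{r,s,3-r-s}^{z,g-z}\,\mathbf{p}_{r,s,3-r-s}^{i,j,k}+\sum_{\substack{s=0\\ s\neq 1}}^{2}\tau_{1,s,2-s}^{z,g-z}\,\mathbf{p}_{1,s,2-s}^{i,j,k}\Big)}{\displaystyle\sum_{g=1}^{\gamma}\varepsilon_g\sum_{z=0}^{g}\binom{g}{z}\tau_{1,1,1}^{z,g-z}}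 . $$
   Context: Univariate basis: $\beta>0$ is fixed and $B_{3,0},\ldots,B_{3,3}$ are sufficiently smooth, linearly independent, non-negative functions on $[0,\beta]$ with $\sum_k B_{3,k}\equiv 1$, $B_{3,0}(0)=1$, $B_{3,k}(0)=0$ for $k=1,2,3$, $B_{3,3}(\beta)=1$, $B_{3,k}(\beta)=0$ for $k=0,1,2$, and $B_{3,k}(x)=B_{3,3-k}(\beta-x)$ for $k=0,1$. Trivariate basis: $\Omega_\beta=\{(u,v,w): u,v,w\in[0,\beta],\ u+v+w=\beta\}$. $\mathcal{T}_\beta=\{T_{r,s,3-r-s}:\Omega_\beta\to\mathbb{R}\}_{r=0,\,s=0}^{3,\,3-r}$ is a linearly independent system of sufficiently smooth non-negative functions that is normalized (its members sum to $1$), and which degenerates on each edge of $\Omega_\beta$ to the univariate basis: the not identically vanishing functions among $T_{r,s,3-r-s}(0,\beta-w,w)$, $w\in[0,\beta]$, are exactly $B_{3,0}(w),\ldots,B_{3,3}(w)$; likewise for $T_{r,s,3-r-s}(u,0,\beta-u)$ with $B_{3,0}(u),\ldots,B_{3,3}(u)$, $u\in[0,\beta]$, and for $T_{r,s,3-r-s}(\beta-v,v,0)$ with $B_{3,0}(v),\ldots,B_{3,3}(v)$, $v\in[0,\beta]$. Mesh and control points: a triangular mesh in $\mathbb{R}^3$ has vertices $\mathbf{p}_i$, counterclockwise oriented triangular faces $\mathcal{F}$, and along each directed edge $(i,j)$ unit tangent vectors $\mathbf{t}_{i,j}$ at $\mathbf{p}_i$ and $\mathbf{t}_{j,i}$ at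 $\mathbf{p}_j$. The real scaling factors $\lambda_{i,j},\lambda_{j,i}$ of each edge are fixed: they are the minimizers of $\sum_{r=1}^{\rho}\theta_r\int_0^\beta\|\mathbf{c}_{i,j}^{(r)}(x)\|^2dx$ for the curve $\mathbf{c}_{i,j}(x)=\mathbf{p}_iB_{3,0}(x)+(\mathbf{p}_i+\lambda_{i,j}\mathbf{t}_{i,j})B_{3,1}(x)+(\mathbf{p}_j+\lambda_{j,i}\mathbf{t}_{j,i})B_{3,2}(x)+\mathbf{p}_jB_{3,3}(x)$, with given $\rho\ge1$ and weights $\theta_r\geq0$ not all zero. For a face $(i,j,k)\in\mathcal{F}$ the triangular surface is $$\mathbf{s}_{i,j,k}(u,v,w)=\sum_{r=0}^{3}\sum_{s=0}^{3-r}\mathbf{p}_{r,s,3-r-s}^{i,j,k}\,T_{r,s,3-r-s}(u,v,w),$$ where all control points except the unknown $\mathbf{p}_{1,1,1}^{i,j,k}$ are given by $\mathbf{p}_{3,0,0}^{i,j,k}=\mathbf{p}_i$, $\mathbf{p}_{2,0,1}^{i,j,k}=\mathbf{p}_i+\lambda_{i,j}\mathbf{t}_{i,j}$, $\mathbf{p}_{1,0,2}^{i,j,k}=\mathbf{p}_j+\lambda_{j,i}\mathbf{t}_{j,i}$, $\mathbf{p}_{0,0,3}^{i,j,k}=\mathbf{p}_j$, $\mathbf{p}_{0,1,2}^{i,j,k}=\mathbf{p}_j+\lambda_{j,k}\mathbf{t}_{j,k}$, $\mathbf{p}_{0,2,1}^{i,j,k}=\mathbf{p}_k+\lambda_{k,j}\mathbf{t}_{k,j}$,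 $\mathbf{p}_{0,3,0}^{i,j,k}=\mathbf{p}_k$, $\mathbf{p}_{1,2,0}^{i,j,k}=\mathbf{p}_k+\lambda_{k,i}\mathbf{t}_{k,i}$, $\mathbf{p}_{2,1,0}^{i,j,k}=\mathbf{p}_i+\lambda_{i,k}\mathbf{t}_{i,k}$. Energy: the generalized quadratic thin-plate spline energy of order $\gamma$ is $$E_{i,j,k}^{\gamma}(\mathbf{p}_{1,1,1}^{i,j,k})=\sum_{g=1}^{\gamma}\varepsilon_g\sum_{z=0}^{g}\binom{g}{z}\int_0^\beta\int_0^{\beta-x}\Big\|\sum_{r=0}^{3}\sum_{s=0}^{3-r}\mathbf{p}_{r,s,3-r-s}^{i,j,k}\frac{\partial^{g}}{\partial x^{z}\partial y^{g-z}}T_{r,s,3-r-s}(x,y,\beta-x-y)\Big\|^2dy\,dx .$$ The coefficients $\tau$ are $$\tau_{r,s,3-r-s}^{z,g-z}:=\int_0^\beta\int_0^{\beta-x}\frac{\partial^{g}}{\partial x^{z}\partial y^{g-z}}T_{r,s,3-r-s}(x,y,\beta-x-y)\cdot\frac{\partial^{g}}{\partial x^{z}\partial y^{g-z}}T_{1,1,1}(x,y,\beta-x-y)\,dy\,dx .$$ $\langle\cdot,\cdot\rangle$ and $\|\cdot\|$ are the Euclidean inner product and norm on $\mathbb{R}^3$. *)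

theory Defs
  imports "HOL-Analysis.Analysis"
begin

section \<open>Derivatives and smoothness on closed domains\<close>

text \<open>
  Functions are only given on compact domains, so all derivatives are taken relative to the
  domain: one-sided at the end points of an interval, and within the closed parameter triangle
  in the bivariate case. Both domains are convex with non-empty interior, so these derivatives
  are unique, and in the interior they are the ordinary (partial) derivatives.
\<close>

definition nth_deriv :: "nat \<Rightarrow> real set \<Rightarrow> (real \<Rightarrow> 'a::real_normed_vector) \<Rightarrow> real \<Rightarrow> 'a" where
  "nth_deriv n D f = ((\<lambda>h x. vector_derivative h (at x within D)) ^^ n) f"

definition smooth1_on :: "nat \<Rightarrow> real set \<Rightarrow> (real \<Rightarrow> real) \<Rightarrow> bool" where
  "smooth1_on m D f \<longleftrightarrow>
     (\<forall>n<m. nth_deriv n D f differentiable_on D) \<and> continuous_on D (nth_deriv m D f)"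

definition partial_x :: "(real \<times> real) set \<Rightarrow> (real \<times> real \<Rightarrow> real) \<Rightarrow> real \<times> real \<Rightarrow> real" where
  "partial_x D f p = frechet_derivative f (at p within D) (1, 0)"

definition partial_y :: "(real \<times> real) set \<Rightarrow> (real \<times> real \<Rightarrow> real) \<Rightarrow> real \<times> real \<Rightarrow> real" where
  "partial_y D f p = frechet_derivative f (at p within D) (0, 1)"

definition partial_xy ::
  "(real \<times> real) set \<Rightarrow> nat \<Rightarrow> nat \<Rightarrow> (real \<times> real \<Rightarrow> real) \<Rightarrow> real \<times> real \<Rightarrow> real" where
  "partial_xy D a b f = (partial_x D ^^ a) ((partial_y D ^^ b) f)"

fun smooth2_on :: "nat \<Rightarrow> (real \<times> real) set \<Rightarrow> (real \<times> real \<Rightarrow> real) \<Rightarrow> bool" where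
  "smooth2_on 0 D f \<longleftrightarrow> continuous_on D f"
| "smooth2_on (Suc m) D f \<longleftrightarrow>
     f differentiable_on D \<and> smooth2_on m D (partial_x D f) \<and> smooth2_on m D (partial_y D f)"

section \<open>The univariate basis\<close>

text \<open>\<open>B k\<close> is \<open>B\<^sub>3\<^sub>,\<^sub>k\<close>; only its values on \<open>{0..\<beta>}\<close> matter.\<close>

definition univariate_basis :: "real \<Rightarrow> nat \<Rightarrow> (nat \<Rightarrow> real \<Rightarrow> real) \<Rightarrow> bool" where
  "univariate_basis \<beta> m B \<longleftrightarrow>
     (\<forall>k\<le>3. smooth1_on m {0..\<beta>} (B k)) \<and>
     (\<forall>c. (\<forall>x\<in>{0..\<beta>}. (\<Sum>k=0..3. c k * B k x) = 0) \<longrightarrow> (\<forall>k\<le>3. c k = 0)) \<and>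
     (\<forall>k\<le>3. \<forall>x\<in>{0..\<beta>}. B k x \<ge> 0) \<and>
     (\<forall>x\<in>{0..\<beta>}. (\<Sum>k=0..3. B k x) = 1) \<and>
     B 0 0 = 1 \<and> (\<forall>k\<in>{1,2,3}. B k 0 = 0) \<and>
     B 3 \<beta> = 1 \<and> (\<forall>k\<in>{0,1,2}. B k \<beta> = 0) \<and>
     (\<forall>k\<in>{0,1}. \<forall>x\<in>{0..\<beta>}. B k x = B (3 - k) (\<beta> - x))"

section \<open>The trivariate basis\<close>

definition Omega :: "real \<Rightarrow> (real \<times> real \<times> real) set" where
  "Omega \<beta> = {(u, v, w). u \<in> {0..\<beta>} \<and> v \<in> {0..\<beta>} \<and> w \<in> {0..\<beta>} \<and> u + v + w = \<beta>}"

definition param_triangle :: "real \<Rightarrow> (real \<times> real) set" where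
  "param_triangle \<beta> = {(x, y). x \<in> {0..\<beta>} \<and> y \<in> {0..\<beta> - x}}"

definition on_param :: "real \<Rightarrow> (real \<times> real \<times> real \<Rightarrow> real) \<Rightarrow> real \<times> real \<Rightarrow> real" where
  "on_param \<beta> g = (\<lambda>(x, y). g (x, y, \<beta> - x - y))"

text \<open>
  \<open>T r s l\<close> is \<open>T\<^sub>r\<^sub>,\<^sub>s\<^sub>,\<^sub>l\<close>; only the indices with \<open>r + s + l = 3\<close> and the values
  on \<open>Omega \<beta>\<close> matter. \<open>trivariate_edge \<beta> B T e\<close> says that the members of the system that do
  not vanish identically along the edge \<open>e\<close> of \<open>Omega \<beta>\<close>, parametrized over \<open>{0..\<beta>}\<close>, are
  exactly the univariate basis functions.
\<close>

definition trivariate_edge ::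
  "real \<Rightarrow> (nat \<Rightarrow> real \<Rightarrow> real) \<Rightarrow> (nat \<Rightarrow> nat \<Rightarrow> nat \<Rightarrow> real \<times> real \<times> real \<Rightarrow> real) \<Rightarrow>
   (real \<Rightarrow> real \<times> real \<times> real) \<Rightarrow> bool" where
  "trivariate_edge \<beta> B T e \<longleftrightarrow>
     {f. (\<exists>r s. r \<le> 3 \<and> s \<le> 3 - r \<and> f = restrict (\<lambda>x. T r s (3 - r - s) (e x)) {0..\<beta>}) \<and>
         (\<exists>x\<in>{0..\<beta>}. f x \<noteq> 0)}
     = (\<lambda>k. restrict (B k) {0..\<beta>}) ` {0..3}"

definition trivariate_basis ::
  "real \<Rightarrow> nat \<Rightarrow> (nat \<Rightarrow> real \<Rightarrow> real) \<Rightarrow>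
   (nat \<Rightarrow> nat \<Rightarrow> nat \<Rightarrow> real \<times> real \<times> real \<Rightarrow> real) \<Rightarrow> bool" where
  "trivariate_basis \<beta> m B T \<longleftrightarrow>
     (\<forall>r\<le>3. \<forall>s\<le>3 - r. smooth2_on m (param_triangle \<beta>) (on_param \<beta> (T r s (3 - r - s)))) \<and>
     (\<forall>c. (\<forall>p\<in>Omega \<beta>. (\<Sum>r=0..3. \<Sum>s=0..3-r. c r s * T r s (3 - r - s) p) = 0) \<longrightarrow>
          (\<forall>r\<le>3. \<forall>s\<le>3 - r. c r s = 0)) \<and>
     (\<forall>r\<le>3. \<forall>s\<le>3 - r. \<forall>p\<in>Omega \<beta>. T r s (3 - r - s) p \<ge> 0) \<and>
     (\<forall>p\<in>Omega \<beta>. (\<Sum>r=0..3. \<Sum>s=0..3-r. T r s (3 - r - s) p) = 1) \<and>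
     trivariate_edge \<beta> B T (\<lambda>w. (0, \<beta> - w, w)) \<and>
     trivariate_edge \<beta> B T (\<lambda>u. (u, 0, \<beta> - u)) \<and>
     trivariate_edge \<beta> B T (\<lambda>v. (\<beta> - v, v, 0))"

section \<open>Meshes and scaling factors\<close>

fun face_edges :: "'i \<times> 'i \<times> 'i \<Rightarrow> ('i \<times> 'i) set" where
  "face_edges (i, j, k) = {(i, j), (j, k), (k, i)}"

definition mesh_edges :: "('i \<times> 'i \<times> 'i) set \<Rightarrow> ('i \<times> 'i) set" where
  "mesh_edges F = (\<Union>f\<in>F. face_edges f \<union> (face_edges f)\<inverse>)"

text \<open>
  The last condition expresses that all faces are listed with the same (counterclockwise)
  orientation: a directed edge belongs to at most one face, where the cyclic rotations of a
  triple count as the same face.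
\<close>

definition triangular_mesh ::
  "'i set \<Rightarrow> ('i \<times> 'i \<times> 'i) set \<Rightarrow> ('i \<Rightarrow> real ^ 3) \<Rightarrow> bool" where
  "triangular_mesh V F P \<longleftrightarrow>
     finite V \<and> F \<subseteq> V \<times> V \<times> V \<and>
     (\<forall>(i, j, k)\<in>F. \<not> collinear {P i, P j, P k}) \<and>
     (\<forall>f\<in>F. \<forall>f'\<in>F. face_edges f \<inter> face_edges f' \<noteq> {} \<longrightarrow> face_edges f = face_edges f')"

definition edge_curve ::
  "(nat \<Rightarrow> real \<Rightarrow> real) \<Rightarrow> ('i \<Rightarrow> real ^ 3) \<Rightarrow> ('i \<Rightarrow> 'i \<Rightarrow> real ^ 3) \<Rightarrow> 'i \<Rightarrow> 'i \<Rightarrow>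
   real \<Rightarrow> real \<Rightarrow> real \<Rightarrow> real ^ 3" where
  "edge_curve B P t i j a b x =
     B 0 x *\<^sub>R P i + B 1 x *\<^sub>R (P i + a *\<^sub>R t i j)
     + B 2 x *\<^sub>R (P j + b *\<^sub>R t j i) + B 3 x *\<^sub>R P j"

definition edge_energy ::
  "real \<Rightarrow> nat \<Rightarrow> (nat \<Rightarrow> real) \<Rightarrow> (nat \<Rightarrow> real \<Rightarrow> real) \<Rightarrow> ('i \<Rightarrow> real ^ 3) \<Rightarrow>
   ('i \<Rightarrow> 'i \<Rightarrow> real ^ 3) \<Rightarrow> 'i \<Rightarrow> 'i \<Rightarrow> real \<Rightarrow> real \<Rightarrow> real" where
  "edge_energy \<beta> \<rho> \<theta> B P t i j a b =
     (\<Sum>r=1..\<rho>. \<theta> r * integral {0..\<beta>}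
        (\<lambda>x. (norm (nth_deriv r {0..\<beta>} (edge_curve B P t i j a b) x))\<^sup>2))"

definition optimal_scaling ::
  "real \<Rightarrow> nat \<Rightarrow> (nat \<Rightarrow> real) \<Rightarrow> (nat \<Rightarrow> real \<Rightarrow> real) \<Rightarrow> ('i \<times> 'i \<times> 'i) set \<Rightarrow>
   ('i \<Rightarrow> real ^ 3) \<Rightarrow> ('i \<Rightarrow> 'i \<Rightarrow> real ^ 3) \<Rightarrow> ('i \<Rightarrow> 'i \<Rightarrow> real) \<Rightarrow> bool" where
  "optimal_scaling \<beta> \<rho> \<theta> B F P t lam \<longleftrightarrow>
     (\<forall>(i, j)\<in>mesh_edges F.
        is_arg_min (\<lambda>(a, b). edge_energy \<beta> \<rho> \<theta> B P t i j a b) (\<lambda>_. True) (lam i j, lam j i))"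

section \<open>Control net, energy and its part depending on the inner control point\<close>

text \<open>
  \<open>control_point P t lam i j k q r s l\<close> is the control point with index \<open>(r, s, l)\<close> of the
  patch over the face \<open>(i, j, k)\<close>, where \<open>q\<close> is the unknown one with index \<open>(1, 1, 1)\<close>.
  The value \<open>0\<close> is a default for triples that are not indices.
\<close>

definition control_point ::
  "('i \<Rightarrow> real ^ 3) \<Rightarrow> ('i \<Rightarrow> 'i \<Rightarrow> real ^ 3) \<Rightarrow> ('i \<Rightarrow> 'i \<Rightarrow> real) \<Rightarrow> 'i \<Rightarrow> 'i \<Rightarrow> 'i \<Rightarrow>
   real ^ 3 \<Rightarrow> nat \<Rightarrow> nat \<Rightarrow> nat \<Rightarrow> real ^ 3" where
  "control_point P t lam i j k q r s l =
     (if (r, s, l) = (3, 0, 0) then P i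
      else if (r, s, l) = (2, 0, 1) then P i + lam i j *\<^sub>R t i j
      else if (r, s, l) = (1, 0, 2) then P j + lam j i *\<^sub>R t j i
      else if (r, s, l) = (0, 0, 3) then P j
      else if (r, s, l) = (0, 1, 2) then P j + lam j k *\<^sub>R t j k
      else if (r, s, l) = (0, 2, 1) then P k + lam k j *\<^sub>R t k j
      else if (r, s, l) = (0, 3, 0) then P k
      else if (r, s, l) = (1, 2, 0) then P k + lam k i *\<^sub>R t k i
      else if (r, s, l) = (2, 1, 0) then P i + lam i k *\<^sub>R t i k
      else if (r, s, l) = (1, 1, 1) then q
      else 0)"

definition partial_T ::
  "real \<Rightarrow> (nat \<Rightarrow> nat \<Rightarrow> nat \<Rightarrow> real \<times> real \<times> real \<Rightarrow> real) \<Rightarrow> nat \<Rightarrow> nat \<Rightarrow>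
   nat \<Rightarrow> nat \<Rightarrow> nat \<Rightarrow> real \<Rightarrow> real \<Rightarrow> real" where
  "partial_T \<beta> T a b r s l x y = partial_xy (param_triangle \<beta>) a b (on_param \<beta> (T r s l)) (x, y)"

definition tau ::
  "real \<Rightarrow> (nat \<Rightarrow> nat \<Rightarrow> nat \<Rightarrow> real \<times> real \<times> real \<Rightarrow> real) \<Rightarrow> nat \<Rightarrow> nat \<Rightarrow>
   nat \<Rightarrow> nat \<Rightarrow> nat \<Rightarrow> real" where
  "tau \<beta> T a b r s l =
     integral {0..\<beta>} (\<lambda>x. integral {0..\<beta> - x} (\<lambda>y.
       partial_T \<beta> T a b r s l x y * partial_T \<beta> T a b 1 1 1 x y))"

text \<open>
  In the following, \<open>p\<close> is a whole control net; in \<open>thin_plate_energy\<close> it includes the inner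
  control point, whereas \<open>outer_sum\<close> omits the index \<open>(1, 1, 1)\<close>.
\<close>

definition thin_plate_energy ::
  "real \<Rightarrow> nat \<Rightarrow> (nat \<Rightarrow> real) \<Rightarrow> (nat \<Rightarrow> nat \<Rightarrow> nat \<Rightarrow> real \<times> real \<times> real \<Rightarrow> real) \<Rightarrow>
   (nat \<Rightarrow> nat \<Rightarrow> nat \<Rightarrow> real ^ 3) \<Rightarrow> real" where
  "thin_plate_energy \<beta> \<gamma> \<epsilon> T p =
     (\<Sum>g=1..\<gamma>. \<epsilon> g * (\<Sum>z=0..g. real (g choose z) *
        integral {0..\<beta>} (\<lambda>x. integral {0..\<beta> - x} (\<lambda>y.
          (norm (\<Sum>r=0..3. \<Sum>s=0..3-r.
             partial_T \<beta> T z (g - z) r s (3 - r - s) x y *\<^sub>R p r s (3 - r - s)))\<^sup>2))))"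

definition outer_sum ::
  "real \<Rightarrow> (nat \<Rightarrow> nat \<Rightarrow> nat \<Rightarrow> real \<times> real \<times> real \<Rightarrow> real) \<Rightarrow>
   (nat \<Rightarrow> nat \<Rightarrow> nat \<Rightarrow> real ^ 3) \<Rightarrow> nat \<Rightarrow> nat \<Rightarrow> real ^ 3" where
  "outer_sum \<beta> T p a b =
     (\<Sum>r\<in>{0..3} - {1}. \<Sum>s=0..3-r. tau \<beta> T a b r s (3 - r - s) *\<^sub>R p r s (3 - r - s))
     + (\<Sum>s\<in>{0..2} - {1}. tau \<beta> T a b 1 s (2 - s) *\<^sub>R p 1 s (2 - s))"

definition weighted_outer_sum ::
  "real \<Rightarrow> nat \<Rightarrow> (nat \<Rightarrow> real) \<Rightarrow> (nat \<Rightarrow> nat \<Rightarrow> nat \<Rightarrow> real \<times> real \<times> real \<Rightarrow> real) \<Rightarrow>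
   (nat \<Rightarrow> nat \<Rightarrow> nat \<Rightarrow> real ^ 3) \<Rightarrow> real ^ 3" where
  "weighted_outer_sum \<beta> \<gamma> \<epsilon> T p =
     (\<Sum>g=1..\<gamma>. \<epsilon> g *\<^sub>R (\<Sum>z=0..g. real (g choose z) *\<^sub>R outer_sum \<beta> T p z (g - z)))"

definition quad_coeff ::
  "real \<Rightarrow> nat \<Rightarrow> (nat \<Rightarrow> real) \<Rightarrow> (nat \<Rightarrow> nat \<Rightarrow> nat \<Rightarrow> real \<times> real \<times> real \<Rightarrow> real) \<Rightarrow> real" where
  "quad_coeff \<beta> \<gamma> \<epsilon> T =
     (\<Sum>g=1..\<gamma>. \<epsilon> g * (\<Sum>z=0..g. real (g choose z) * tau \<beta> T z (g - z) 1 1 1))"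

definition reduced_energy ::
  "real \<Rightarrow> nat \<Rightarrow> (nat \<Rightarrow> real) \<Rightarrow> (nat \<Rightarrow> nat \<Rightarrow> nat \<Rightarrow> real \<times> real \<times> real \<Rightarrow> real) \<Rightarrow>
   (nat \<Rightarrow> nat \<Rightarrow> nat \<Rightarrow> real ^ 3) \<Rightarrow> real ^ 3 \<Rightarrow> real" where
  "reduced_energy \<beta> \<gamma> \<epsilon> T p q =
     2 * (\<Sum>g=1..\<gamma>. \<epsilon> g * (\<Sum>z=0..g. real (g choose z) * inner (outer_sum \<beta> T p z (g - z)) q))
     + quad_coeff \<beta> \<gamma> \<epsilon> T * inner q q"

definition reduced_energy_gradient ::
  "real \<Rightarrow> nat \<Rightarrow> (nat \<Rightarrow> real) \<Rightarrow> (nat \<Rightarrow> nat \<Rightarrow> nat \<Rightarrow> real \<times> real \<times> real \<Rightarrow> real) \<Rightarrow>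
   (nat \<Rightarrow> nat \<Rightarrow> nat \<Rightarrow> real ^ 3) \<Rightarrow> real ^ 3 \<Rightarrow> real ^ 3" where
  "reduced_energy_gradient \<beta> \<gamma> \<epsilon> T p q =
     2 *\<^sub>R weighted_outer_sum \<beta> \<gamma> \<epsilon> T p + (2 * quad_coeff \<beta> \<gamma> \<epsilon> T) *\<^sub>R q"

end

theory Submission
  imports Defs
begin

text \<open>
  With all other control points fixed, every partial derivative of the surface is an affine
  function of the inner control point \<open>q\<close>: it has the form \<open>a + h q\<close>, where the vector \<open>a\<close>
  collects the boundary control points and \<open>h\<close> is a partial derivative of \<open>T\<^sub>1\<^sub>,\<^sub>1\<^sub>,\<^sub>1\<close>. Hence
  \<open>\<parallel>a + h q\<parallel>\<^sup>2 = \<parallel>a\<parallel>\<^sup>2 + 2 h \<langle>a, q\<rangle> + h\<^sup>2 \<langle>q, q\<rangle>\<close>, and integration turns the products of \<open>h\<close>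
  with partial derivatives of basis functions into the coefficients \<open>\<tau>\<close>. The term without
  \<open>q\<close> is the constant by which the energy and the reduced energy differ
  (\<open>thin_plate_energy_eq_reduced_energy\<close>).

  The analytic point is that the integral may be split. The integral is an iterated one over a
  triangle, so besides the integrands on the vertical segments, the function of \<open>x\<close> obtained from
  the inner integration must be integrable as well. Both hold because the partial
  derivatives up to order \<open>\<gamma>\<close> are continuous on the closed triangle
  (\<open>continuous_on_partial_xy\<close>, \<open>continuous_on_inner_integral\<close>).

  What remains is a quadratic polynomial \<open>2 \<langle>w, q\<rangle> + c \<langle>q, q\<rangle>\<close> on an inner product space. Its
  gradient \<open>2 w + 2 c q\<close> is affine and, when \<open>c \<noteq> 0\<close>, vanishes exactly at \<open>- w / c\<close>.
\<close>

section \<open>Linearity of the iterated integral over the parameter triangle\<close>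

definition triangle_integral :: "real \<Rightarrow> (real \<times> real \<Rightarrow> real) \<Rightarrow> real" where
  "triangle_integral \<beta> f = integral {0..\<beta>} (\<lambda>x. integral {0..\<beta> - x} (\<lambda>y. f (x, y)))"

lemma continuous_on_section:
  fixes f :: "real \<times> real \<Rightarrow> real"
  assumes "continuous_on (param_triangle \<beta>) f" and "x \<in> {0..\<beta>}"
  shows "continuous_on {0..\<beta> - x} (\<lambda>y. f (x, y))"
  by (rule continuous_on_compose2[OF assms(1)])
    (use assms(2) in \<open>auto simp: param_triangle_def intro!: continuous_intros\<close>)

text \<open>
  The interval of the inner integral depends on \<open>x\<close>. Substituting \<open>y = s (\<beta> - x)\<close> moves this
  dependence into the integrand, so that continuity of parametric integrals over the fixed
  interval \<open>{0..1}\<close> applies.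
\<close>

lemma continuous_on_inner_integral:
  fixes f :: "real \<times> real \<Rightarrow> real"
  assumes f: "continuous_on (param_triangle \<beta>) f"
  shows "continuous_on {0..\<beta>} (\<lambda>x. integral {0..\<beta> - x} (\<lambda>y. f (x, y)))"
proof -
  have in_triangle: "(x, s * (\<beta> - x)) \<in> param_triangle \<beta>"
    if "x \<in> {0..\<beta>}" "s \<in> {0..1}" for x s
    using that mult_right_mono[of s 1 "\<beta> - x"] by (auto simp: param_triangle_def)
  have rescale: "integral {0..\<beta> - x} (\<lambda>y. f (x, y))
      = (\<beta> - x) * integral {0..1} (\<lambda>s. f (x, s * (\<beta> - x)))"
    if x: "x \<in> {0..\<beta>}" for x
  proof -
    \<comment> \<open>At \<open>x = \<beta>\<close> the substitution is constant and both integrals are \<open>0\<close>.\<close>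
    have "((\<lambda>s. (\<beta> - x) *\<^sub>R f (x, s * (\<beta> - x))) has_integral
        integral {0 * (\<beta> - x)..1 * (\<beta> - x)} (\<lambda>y. f (x, y))) {0..1}"
    proof (rule has_integral_substitution)
      show "continuous_on {0..\<beta> - x} (\<lambda>y. f (x, y))"
        by (rule continuous_on_section[OF f x])
      show "(\<lambda>s. s * (\<beta> - x)) ` {0..1} \<subseteq> {0..\<beta> - x}"
        using in_triangle[OF x] by (auto simp: param_triangle_def)
    qed (use x in \<open>auto intro!: derivative_eq_intros\<close>)
    then show ?thesis
      by (simp add: has_integral_iff)
  qed
  have "continuous_on ({0..\<beta>} \<times> cbox 0 1) (\<lambda>(x, s). f (x, s * (\<beta> - x)))"
    unfolding case_prod_beta
    by (rule continuous_on_compose2[OF f])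
      (use in_triangle in \<open>auto intro!: continuous_intros\<close>)
  then have "continuous_on {0..\<beta>} (\<lambda>x. integral {0..1} (\<lambda>s. f (x, s * (\<beta> - x))))"
    using integral_continuous_on_param by fastforce
  then have "continuous_on {0..\<beta>} (\<lambda>x. (\<beta> - x) * integral {0..1} (\<lambda>s. f (x, s * (\<beta> - x))))"
    by (intro continuous_intros)
  then show ?thesis
    by (subst continuous_on_cong[OF refl rescale])
qed

lemma triangle_integral_add:
  assumes f: "continuous_on (param_triangle \<beta>) f" and g: "continuous_on (param_triangle \<beta>) g"
  shows "triangle_integral \<beta> (\<lambda>p. f p + g p) = triangle_integral \<beta> f + triangle_integral \<beta> g"
proof -
  have "integral {0..\<beta> - x} (\<lambda>y. f (x, y) + g (x, y))
      = integral {0..\<beta> - x} (\<lambda>y. f (x, y)) + integral {0..\<beta> - x} (\<lambda>y. g (x, y))"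
    if "x \<in> {0..\<beta>}" for x
    by (intro integral_add integrable_continuous_real continuous_on_section f g that)
  then have "triangle_integral \<beta> (\<lambda>p. f p + g p) = integral {0..\<beta>}
      (\<lambda>x. integral {0..\<beta> - x} (\<lambda>y. f (x, y)) + integral {0..\<beta> - x} (\<lambda>y. g (x, y)))"
    unfolding triangle_integral_def by (intro integral_cong) auto
  also have "\<dots> = triangle_integral \<beta> f + triangle_integral \<beta> g"
    unfolding triangle_integral_def
    by (intro integral_add integrable_continuous_real continuous_on_inner_integral f g)
  finally show ?thesis .
qed

lemma triangle_integral_mult_right:
  "triangle_integral \<beta> (\<lambda>p. f p * c) = triangle_integral \<beta> f * c"
  by (simp add: triangle_integral_def)

lemma triangle_integral_sum:
  assumes "finite J" and "\<And>i. i \<in> J \<Longrightarrow> continuous_on (param_triangle \<beta>) (f i)"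
  shows "triangle_integral \<beta> (\<lambda>p. \<Sum>i\<in>J. f i p) = (\<Sum>i\<in>J. triangle_integral \<beta> (f i))"
  using assms
proof (induction J rule: finite_induct)
  case empty
  show ?case by (simp add: triangle_integral_def)
next
  case (insert i J)
  then show ?case
    by (simp add: triangle_integral_add continuous_on_sum)
qed

section \<open>Expanding the squared norm\<close>

text \<open>
  This is the step that produces the \<open>\<tau>\<close> coefficients: for \<open>f i\<close> and \<open>h\<close> the partial derivatives
  of the outer basis functions and of \<open>T\<^sub>1\<^sub>,\<^sub>1\<^sub>,\<^sub>1\<close>, the integrals of \<open>f i * h\<close> and \<open>h * h\<close> are the
  numbers \<open>\<tau>\<close>.
\<close>

lemma triangle_integral_norm_square_expansion:
  fixes c :: "'a \<Rightarrow> 'v::real_inner" and q :: 'v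
  assumes J: "finite J" and f: "\<And>i. i \<in> J \<Longrightarrow> continuous_on (param_triangle \<beta>) (f i)"
    and h: "continuous_on (param_triangle \<beta>) h"
  shows "triangle_integral \<beta> (\<lambda>p. (norm ((\<Sum>i\<in>J. f i p *\<^sub>R c i) + h p *\<^sub>R q))\<^sup>2)
      = triangle_integral \<beta> (\<lambda>p. (norm (\<Sum>i\<in>J. f i p *\<^sub>R c i))\<^sup>2)
        + 2 * inner (\<Sum>i\<in>J. triangle_integral \<beta> (\<lambda>p. f i p * h p) *\<^sub>R c i) q
        + triangle_integral \<beta> (\<lambda>p. h p * h p) * inner q q"
proof -
  have expand: "(norm ((\<Sum>i\<in>J. f i p *\<^sub>R c i) + h p *\<^sub>R q))\<^sup>2
      = (norm (\<Sum>i\<in>J. f i p *\<^sub>R c i))\<^sup>2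
        + (\<Sum>i\<in>J. (f i p * h p) * (2 * inner (c i) q)) + (h p * h p) * inner q q" for p
  proof -
    have "(norm (a + s *\<^sub>R q))\<^sup>2 = (norm a)\<^sup>2 + 2 * s * inner a q + (s * s) * inner q q" for a s
      by (simp add: power2_norm_eq_inner inner_add_left inner_add_right
          inner_commute[of q a] algebra_simps)
    then show ?thesis
      by (simp add: inner_sum_left sum_distrib_left mult_ac)
  qed
  have "triangle_integral \<beta> (\<lambda>p. \<Sum>i\<in>J. (f i p * h p) * (2 * inner (c i) q))
      = (\<Sum>i\<in>J. triangle_integral \<beta> (\<lambda>p. f i p * h p) * (2 * inner (c i) q))"
    by (subst triangle_integral_sum)
      (auto simp: triangle_integral_mult_right intro!: J f h continuous_intros)
  also have "\<dots> = 2 * inner (\<Sum>i\<in>J. triangle_integral \<beta> (\<lambda>p. f i p * h p) *\<^sub>R c i) q"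
    by (simp add: inner_sum_left sum_distrib_left mult_ac)
  finally have cross: "triangle_integral \<beta> (\<lambda>p. \<Sum>i\<in>J. (f i p * h p) * (2 * inner (c i) q))
      = 2 * inner (\<Sum>i\<in>J. triangle_integral \<beta> (\<lambda>p. f i p * h p) *\<^sub>R c i) q" .
  have "continuous_on (param_triangle \<beta>) (\<lambda>p. (norm (\<Sum>i\<in>J. f i p *\<^sub>R c i))\<^sup>2)"
    and "continuous_on (param_triangle \<beta>) (\<lambda>p. \<Sum>i\<in>J. (f i p * h p) * (2 * inner (c i) q))"
    and "continuous_on (param_triangle \<beta>) (\<lambda>p. (h p * h p) * inner q q)"
    by (auto intro!: continuous_intros f h)
  then show ?thesis
    unfolding expand
    by (simp add: triangle_integral_add continuous_on_add cross triangle_integral_mult_right)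
qed

section \<open>Continuity of the partial derivatives\<close>

lemma smooth2_on_imp_continuous_on:
  "smooth2_on m D f \<Longrightarrow> continuous_on D f"
  by (cases m) (auto simp: differentiable_imp_continuous_on)

lemma smooth2_on_iterated_partial_y:
  "smooth2_on (b + m) D f \<Longrightarrow> smooth2_on m D ((partial_y D ^^ b) f)"
proof (induction b arbitrary: m)
  case (Suc b)
  from Suc.prems have "smooth2_on (Suc m) D ((partial_y D ^^ b) f)"
    by (intro Suc.IH) simp
  then show ?case by simp
qed simp

lemma smooth2_on_iterated_partial_x:
  "smooth2_on (a + m) D f \<Longrightarrow> smooth2_on m D ((partial_x D ^^ a) f)"
proof (induction a arbitrary: m)
  case (Suc a)
  from Suc.prems have "smooth2_on (Suc m) D ((partial_x D ^^ a) f)"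
    by (intro Suc.IH) simp
  then show ?case by simp
qed simp

text \<open>
  Smoothness of order \<open>m\<close> supplies the partial derivatives one at a time, in any order, so \<open>b\<close>
  differentiations in \<open>y\<close> followed by \<open>a\<close> in \<open>x\<close> leave a function that is still smooth of order
  \<open>m - a - b\<close>.
\<close>

lemma continuous_on_partial_xy:
  assumes "smooth2_on m D f" and "a + b \<le> m"
  shows "continuous_on D (partial_xy D a b f)"
proof -
  have "smooth2_on (b + (a + (m - a - b))) D f"
    using assms by simp
  then show ?thesis
    unfolding partial_xy_def
    by (intro smooth2_on_imp_continuous_on smooth2_on_iterated_partial_x
        smooth2_on_iterated_partial_y)
qed

section \<open>The energy as a quadratic polynomial in the inner control point\<close>

definition outer_indices :: "(nat \<times> nat) set" where
  "outer_indices = (SIGMA r:{0..3}. {0..3 - r}) - {(1, 1)}"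

lemma sum_indices_split:
  fixes h :: "nat \<Rightarrow> nat \<Rightarrow> 'a::comm_monoid_add"
  shows "(\<Sum>r=0..3. \<Sum>s=0..3-r. h r s) = (\<Sum>(r, s)\<in>outer_indices. h r s) + h 1 1"
proof -
  have "(\<Sum>r=0..3. \<Sum>s=0..3-r. h r s) = (\<Sum>(r, s)\<in>(SIGMA r:{0..3}. {0..3 - r}). h r s)"
    by (simp add: sum.Sigma)
  also have "\<dots> = h 1 1 + (\<Sum>(r, s)\<in>outer_indices. h r s)"
    unfolding outer_indices_def by (subst sum.remove[of _ "(1, 1)"]) auto
  finally show ?thesis by (simp add: add.commute)
qed

text \<open>
  The sum is given in two pieces, the rows \<open>r \<noteq> 1\<close> and the row \<open>r = 1\<close> without its middle entry.
  A single finite index set makes the expansion of the squared norm applicable.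
\<close>

lemma outer_sum_eq:
  "outer_sum \<beta> T p a b
    = (\<Sum>(r, s)\<in>outer_indices. tau \<beta> T a b r s (3 - r - s) *\<^sub>R p r s (3 - r - s))"
proof -
  define h where "h r s = tau \<beta> T a b r s (3 - r - s) *\<^sub>R p r s (3 - r - s)" for r s
  have "(\<Sum>r=0..3. \<Sum>s=0..3-r. h r s)
      = (\<Sum>s=0..3-1. h 1 s) + (\<Sum>r\<in>{0..3} - {1}. \<Sum>s=0..3-r. h r s)"
    by (rule sum.remove) auto
  also have "(\<Sum>s=0..3-1. h 1 s) = h 1 1 + (\<Sum>s\<in>{0..2} - {1}. h 1 s)"
    by (subst sum.remove[of _ 1]) auto
  finally have "(\<Sum>(r, s)\<in>outer_indices. h r s)
      = (\<Sum>s\<in>{0..2} - {1}. h 1 s) + (\<Sum>r\<in>{0..3} - {1}. \<Sum>s=0..3-r. h r s)"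
    unfolding sum_indices_split by simp
  then show ?thesis
    unfolding outer_sum_def by (simp add: h_def add.commute)
qed

lemma tau_eq_triangle_integral:
  "tau \<beta> T a b r s l = triangle_integral \<beta>
     (\<lambda>p. partial_xy (param_triangle \<beta>) a b (on_param \<beta> (T r s l)) p
        * partial_xy (param_triangle \<beta>) a b (on_param \<beta> (T 1 1 1)) p)"
  by (simp add: tau_def triangle_integral_def partial_T_def)

lemma order_energy_expansion:
  fixes p :: "nat \<Rightarrow> nat \<Rightarrow> nat \<Rightarrow> real ^ 3"
  assumes smooth: "\<forall>r\<le>3. \<forall>s\<le>3 - r.
      smooth2_on m (param_triangle \<beta>) (on_param \<beta> (T r s (3 - r - s)))"
    and ord: "a + b \<le> m"
  shows "integral {0..\<beta>} (\<lambda>x. integral {0..\<beta> - x} (\<lambda>y.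
      (norm (\<Sum>r=0..3. \<Sum>s=0..3-r.
         partial_T \<beta> T a b r s (3 - r - s) x y *\<^sub>R p r s (3 - r - s)))\<^sup>2))
    = triangle_integral \<beta> (\<lambda>z. (norm (\<Sum>(r, s)\<in>outer_indices.
         partial_T \<beta> T a b r s (3 - r - s) (fst z) (snd z) *\<^sub>R p r s (3 - r - s)))\<^sup>2)
      + 2 * inner (outer_sum \<beta> T p a b) (p 1 1 1)
      + tau \<beta> T a b 1 1 1 * inner (p 1 1 1) (p 1 1 1)"
proof -
  define f where "f = (\<lambda>(r, s). partial_xy (param_triangle \<beta>) a b (on_param \<beta> (T r s (3 - r - s))))"
  have cont: "continuous_on (param_triangle \<beta>) (f (r, s))" if "r \<le> 3" "s \<le> 3 - r" for r s
  proof -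
    have "smooth2_on m (param_triangle \<beta>) (on_param \<beta> (T r s (3 - r - s)))"
      using smooth that by blast
    then show ?thesis
      unfolding f_def prod.case using ord by (rule continuous_on_partial_xy)
  qed
  have "integral {0..\<beta>} (\<lambda>x. integral {0..\<beta> - x} (\<lambda>y.
      (norm (\<Sum>r=0..3. \<Sum>s=0..3-r.
         partial_T \<beta> T a b r s (3 - r - s) x y *\<^sub>R p r s (3 - r - s)))\<^sup>2))
    = triangle_integral \<beta> (\<lambda>z. (norm ((\<Sum>i\<in>outer_indices.
         f i z *\<^sub>R (case i of (r, s) \<Rightarrow> p r s (3 - r - s))) + f (1, 1) z *\<^sub>R p 1 1 1))\<^sup>2)"
    unfolding triangle_integral_def sum_indices_split
    by (simp add: f_def partial_T_def case_prod_beta)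
  also have "\<dots> = triangle_integral \<beta> (\<lambda>z. (norm (\<Sum>i\<in>outer_indices.
         f i z *\<^sub>R (case i of (r, s) \<Rightarrow> p r s (3 - r - s))))\<^sup>2)
      + 2 * inner (\<Sum>i\<in>outer_indices. triangle_integral \<beta> (\<lambda>z. f i z * f (1, 1) z)
           *\<^sub>R (case i of (r, s) \<Rightarrow> p r s (3 - r - s))) (p 1 1 1)
      + triangle_integral \<beta> (\<lambda>z. f (1, 1) z * f (1, 1) z) * inner (p 1 1 1) (p 1 1 1)"
    by (rule triangle_integral_norm_square_expansion)
      (auto simp: outer_indices_def intro!: cont)
  finally show ?thesis
    by (simp add: f_def outer_sum_eq tau_eq_triangle_integral partial_T_def case_prod_beta)
qed

definition outer_energy ::
  "real \<Rightarrow> nat \<Rightarrow> (nat \<Rightarrow> real) \<Rightarrow> (nat \<Rightarrow> nat \<Rightarrow> nat \<Rightarrow> real \<times> real \<times> real \<Rightarrow> real) \<Rightarrow>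
   (nat \<Rightarrow> nat \<Rightarrow> nat \<Rightarrow> real ^ 3) \<Rightarrow> real" where
  "outer_energy \<beta> \<gamma> \<epsilon> T p =
     (\<Sum>g=1..\<gamma>. \<epsilon> g * (\<Sum>z=0..g. real (g choose z) *
        triangle_integral \<beta> (\<lambda>xy. (norm (\<Sum>(r, s)\<in>outer_indices.
          partial_T \<beta> T z (g - z) r s (3 - r - s) (fst xy) (snd xy) *\<^sub>R p r s (3 - r - s)))\<^sup>2)))"

text \<open>
  Every partial derivative in the energy has order \<open>z + (g - z) = g \<le> \<gamma>\<close>, so smoothness of order
  \<open>\<gamma>\<close> suffices to expand each term separately.
\<close>

lemma thin_plate_energy_eq_reduced_energy:
  assumes "\<forall>r\<le>3. \<forall>s\<le>3 - r.
      smooth2_on \<gamma> (param_triangle \<beta>) (on_param \<beta> (T r s (3 - r - s)))"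
  shows "thin_plate_energy \<beta> \<gamma> \<epsilon> T p
      = reduced_energy \<beta> \<gamma> \<epsilon> T p (p 1 1 1) + outer_energy \<beta> \<gamma> \<epsilon> T p"
proof -
  have "thin_plate_energy \<beta> \<gamma> \<epsilon> T p = (\<Sum>g=1..\<gamma>. \<epsilon> g * (\<Sum>z=0..g. real (g choose z) *
      (triangle_integral \<beta> (\<lambda>xy. (norm (\<Sum>(r, s)\<in>outer_indices.
         partial_T \<beta> T z (g - z) r s (3 - r - s) (fst xy) (snd xy) *\<^sub>R p r s (3 - r - s)))\<^sup>2)
      + 2 * inner (outer_sum \<beta> T p z (g - z)) (p 1 1 1)
      + tau \<beta> T z (g - z) 1 1 1 * inner (p 1 1 1) (p 1 1 1))))"
    unfolding thin_plate_energy_def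
    by (intro sum.cong refl arg_cong2[where f = "(*)"]
        order_energy_expansion[where m = \<gamma>] assms) auto
  then show ?thesis
    unfolding reduced_energy_def outer_energy_def quad_coeff_def
    by (simp add: sum.distrib sum_distrib_left sum_distrib_right distrib_left mult_ac)
qed

lemma outer_sum_cong:
  assumes "\<And>r s. (r, s) \<in> outer_indices \<Longrightarrow> p r s (3 - r - s) = p' r s (3 - r - s)"
  shows "outer_sum \<beta> T p a b = outer_sum \<beta> T p' a b"
  unfolding outer_sum_eq using assms by (intro sum.cong) auto

lemma outer_energy_cong:
  assumes "\<And>r s. (r, s) \<in> outer_indices \<Longrightarrow> p r s (3 - r - s) = p' r s (3 - r - s)"
  shows "outer_energy \<beta> \<gamma> \<epsilon> T p = outer_energy \<beta> \<gamma> \<epsilon> T p'"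
proof -
  have "(\<Sum>(r, s)\<in>outer_indices. d r s *\<^sub>R p r s (3 - r - s))
      = (\<Sum>(r, s)\<in>outer_indices. d r s *\<^sub>R p' r s (3 - r - s))" for d :: "nat \<Rightarrow> nat \<Rightarrow> real"
    using assms by (intro sum.cong) auto
  then show ?thesis
    unfolding outer_energy_def by simp
qed

lemma control_point_outer:
  assumes "(r, s) \<in> outer_indices"
  shows "control_point P t lam i j k q r s (3 - r - s)
      = control_point P t lam i j k q' r s (3 - r - s)"
proof -
  have "(r, s, 3 - r - s) \<noteq> (1, 1, 1)"
    using assms by (auto simp: outer_indices_def)
  then show ?thesis
    by (simp only: control_point_def if_False)
qed

lemma control_point_inner: "control_point P t lam i j k q 1 1 1 = q"
  by (simp add: control_point_def)

lemma reduced_energy_eq: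
  "reduced_energy \<beta> \<gamma> \<epsilon> T p q
    = 2 * inner (weighted_outer_sum \<beta> \<gamma> \<epsilon> T p) q + quad_coeff \<beta> \<gamma> \<epsilon> T * inner q q"
  by (simp add: reduced_energy_def weighted_outer_sum_def inner_sum_left)

section \<open>Critical points of quadratic polynomials\<close>

lemma GDERIV_quadratic:
  fixes w q :: "'v::real_inner"
  shows "GDERIV (\<lambda>q. 2 * inner w q + c * inner q q) q :> 2 *\<^sub>R w + (2 * c) *\<^sub>R q"
  unfolding gderiv_def
  by (auto intro!: derivative_eq_intros simp: inner_add_right inner_commute algebra_simps)

lemma GDERIV_unique:
  assumes "GDERIV f x :> d" and "GDERIV f x :> d'"
  shows "d = d'"
proof -
  have "(\<lambda>h. inner h d) = (\<lambda>h. inner h d')"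
    using assms unfolding gderiv_def by (rule has_derivative_unique)
  then show ?thesis
    by (simp add: fun_eq_iff vector_eq_ldot)
qed

lemma affine_zero_iff:
  fixes w q :: "'v::real_vector"
  assumes "c \<noteq> 0"
  shows "2 *\<^sub>R w + (2 * c) *\<^sub>R q = 0 \<longleftrightarrow> q = - (w /\<^sub>R c)"
proof -
  have "2 *\<^sub>R w + (2 * c) *\<^sub>R q = (2 * c) *\<^sub>R (q + w /\<^sub>R c)"
    using assms by (simp add: scaleR_add_right)
  then show ?thesis
    using assms by (simp add: eq_neg_iff_add_eq_0)
qed

theorem proposition4p1:
  fixes \<beta> :: real and \<rho> \<gamma> :: nat and \<theta> \<epsilon> :: "nat \<Rightarrow> real"
    and B :: "nat \<Rightarrow> real \<Rightarrow> real"
    and T :: "nat \<Rightarrow> nat \<Rightarrow> nat \<Rightarrow> real \<times> real \<times> real \<Rightarrow> real"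
    and V :: "'i set" and F :: "('i \<times> 'i \<times> 'i) set"
    and P :: "'i \<Rightarrow> real ^ 3" and t :: "'i \<Rightarrow> 'i \<Rightarrow> real ^ 3"
    and lam :: "'i \<Rightarrow> 'i \<Rightarrow> real" and i j k :: 'i
  assumes "\<beta> > 0"
    and "\<rho> \<ge> 1" and "\<forall>r\<in>{1..\<rho>}. \<theta> r \<ge> 0" and "\<exists>r\<in>{1..\<rho>}. \<theta> r \<noteq> 0"
    and "\<gamma> \<ge> 1" and "\<forall>g\<in>{1..\<gamma>}. \<epsilon> g \<ge> 0" and "\<exists>g\<in>{1..\<gamma>}. \<epsilon> g \<noteq> 0"
    and "univariate_basis \<beta> \<rho> B"
    and "trivariate_basis \<beta> \<gamma> B T"
    and "triangular_mesh V F P"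
    and "\<forall>(a, b)\<in>mesh_edges F. norm (t a b) = 1"
    and "optimal_scaling \<beta> \<rho> \<theta> B F P t lam"
    and "(i, j, k) \<in> F"
  defines "net \<equiv> control_point P t lam i j k"
  defines "E \<equiv> (\<lambda>q. thin_plate_energy \<beta> \<gamma> \<epsilon> T (net q))"
    and "E_red \<equiv> (\<lambda>q. reduced_energy \<beta> \<gamma> \<epsilon> T (net q) q)"
    and "grad \<equiv> (\<lambda>q. reduced_energy_gradient \<beta> \<gamma> \<epsilon> T (net q) q)"
    and "sol \<equiv> - (weighted_outer_sum \<beta> \<gamma> \<epsilon> T (net 0) /\<^sub>R quad_coeff \<beta> \<gamma> \<epsilon> T)"
  shows "(\<exists>C. \<forall>q. E q = E_red q + C) \<and>
         (\<forall>q. GDERIV E_red q :> grad q) \<and>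
         (quad_coeff \<beta> \<gamma> \<epsilon> T \<noteq> 0 \<longrightarrow>
            (\<forall>q. grad q = 0 \<longleftrightarrow> q = sol) \<and>
            (\<forall>q. GDERIV E_red q :> 0 \<longleftrightarrow> q = sol))"
proof -
  define w where "w = weighted_outer_sum \<beta> \<gamma> \<epsilon> T (net 0)"
  define c where "c = quad_coeff \<beta> \<gamma> \<epsilon> T"
  \<comment> \<open>The net depends on \<open>q\<close> only at the index \<open>(1, 1, 1)\<close>, so the rest may be evaluated at \<open>q = 0\<close>.\<close>
  have outer: "net q r s (3 - r - s) = net 0 r s (3 - r - s)" if "(r, s) \<in> outer_indices" for q r s
    unfolding net_def using that by (rule control_point_outer)
  have w_eq: "weighted_outer_sum \<beta> \<gamma> \<epsilon> T (net q) = w" for q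
  proof -
    have "outer_sum \<beta> T (net q) a b = outer_sum \<beta> T (net 0) a b" for a b
      by (rule outer_sum_cong) (rule outer)
    then show ?thesis
      by (simp add: w_def weighted_outer_sum_def)
  qed
  have E_red_eq: "E_red = (\<lambda>q. 2 * inner w q + c * inner q q)"
    by (simp add: E_red_def reduced_energy_eq w_eq c_def)
  have grad_eq: "grad q = 2 *\<^sub>R w + (2 * c) *\<^sub>R q" for q
    by (simp add: grad_def reduced_energy_gradient_def w_eq c_def)
  have "E q = E_red q + outer_energy \<beta> \<gamma> \<epsilon> T (net 0)" for q
  proof -
    have "\<forall>r\<le>3. \<forall>s\<le>3 - r. smooth2_on \<gamma> (param_triangle \<beta>) (on_param \<beta> (T r s (3 - r - s)))"
      using \<open>trivariate_basis \<beta> \<gamma> B T\<close> unfolding trivariate_basis_def by blast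
    then have "E q = reduced_energy \<beta> \<gamma> \<epsilon> T (net q) (net q 1 1 1) + outer_energy \<beta> \<gamma> \<epsilon> T (net q)"
      unfolding E_def by (rule thin_plate_energy_eq_reduced_energy)
    also have "net q 1 1 1 = q"
      unfolding net_def by (rule control_point_inner)
    also have "outer_energy \<beta> \<gamma> \<epsilon> T (net q) = outer_energy \<beta> \<gamma> \<epsilon> T (net 0)"
      by (rule outer_energy_cong) (rule outer)
    finally show ?thesis
      by (simp add: E_red_def)
  qed
  moreover have gderiv: "GDERIV E_red q :> grad q" for q
    unfolding E_red_eq grad_eq by (rule GDERIV_quadratic)
  moreover have zero: "grad q = 0 \<longleftrightarrow> q = sol" if "c \<noteq> 0" for q
    unfolding grad_eq sol_def c_def[symmetric] w_def[symmetric] using that by (rule affine_zero_iff)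
  moreover have "GDERIV E_red q :> 0 \<longleftrightarrow> grad q = 0" for q
    using gderiv[of q] GDERIV_unique by metis
  ultimately show ?thesis
    unfolding c_def by blast
qed

end
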